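(* Let $\Gamma$ be a basis, $M$ a $CL$-term and $\sigma$ a simple type. If $\Gamma\models M:\sigma$, then $\Gamma\vdash_{CL^=}M:\sigma$.
   Context: $CL$-terms: $M,N ::= x \mid \mathsf{S} \mid \mathsf{K} \mid \mathsf{I} \mid MN$ over a countable set $V$ of term variables. The equational theory $\mathcal{EQ}^\eta$ has axioms $M=M$, $\mathsf S MNL=(ML)(NL)$, $\mathsf K MN=M$, $\mathsf I M=M$ and rules: symmetry, transitivity, from $M=N$ infer $MP=NP$ and $PM=PN$, and from $Mx=Nx$ with $x$ not occurring in $M$ or $N$ infer $M=N$. Simple types $\sigma ::= a\mid\sigma\to\tau$ (set ${\sf Types}$). A basis is a set of declarations $x:\sigma$ with pairwise distinct variables. The system $CL_\rightarrow^=$ derives $\Gamma\vdash_{CL^=}M:\sigma$ by: $x:\sigma$ if $x:\sigma\in\Gamma$; $\mathsf S:(\sigma\to(\rho\to\tau))\to((\sigma\to\rho)\to(\sigma\to\tau))$; $\mathsf K:\sigma\to(\tau\to\sigma)$; $\mathsf I:\sigma\to\sigma$ (all types); from $M:\sigma\to\tau$ and $N:\sigma$ infer $MN:\tau$; and (eq): from $\Gamma\vdash_{CL^=}M:\sigma$ and $M=N$ provable in $\mathcal{EQ}^\eta$ infer $\Gamma\vdash_{CL^=}N:\sigma$. An applicative structure for $LCL$ is $\langle D,\{A^\sigma\}_{\sigma\in{\sf Types}},\cdot,\mathbf s,\mathbf k,\mathbf i\rangle$ with $D$ nonempty, $A^\sigma\subseteq D$, $\cdot:D\times D\to D$ extensional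 (if $d_1\cdot e=d_2\cdot e$ for all $e$ then $d_1=d_2$) and mapping $A^{\sigma\to\tau}\times A^\sigma$ into $A^\tau$; $\mathbf s\in A^{(\sigma\to(\tau\to\rho))\to((\sigma\to\tau)\to(\sigma\to\rho))}$ for all $\sigma,\tau,\rho$ with $((\mathbf s\cdot d)\cdot e)\cdot f=(d\cdot f)\cdot(e\cdot f)$; $\mathbf k\in A^{\sigma\to(\tau\to\sigma)}$ for all $\sigma,\tau$ with $(\mathbf k\cdot d)\cdot e=d$; $\mathbf i\in A^{\sigma\to\sigma}$ for all $\sigma$ with $\mathbf i\cdot d=d$. An $LCL$-model $\mathcal M_\rho$ is such a structure with an environment $\rho:V\to D$. Interpretation: $[\![x]\!]_\rho=\rho(x)$, $[\![\mathsf S]\!]_\rho=\mathbf s$, $[\![\mathsf K]\!]_\rho=\mathbf k$, $[\![\mathsf I]\!]_\rho=\mathbf i$, $[\![MN]\!]_\rho=[\![M]\!]_\rho\cdot[\![N]\!]_\rho$. $\mathcal M_\rho\models M:\sigma$ iff $[\![M]\!]_\rho\in A^\sigma$. $\Gamma\models M:\sigma$ means every $LCL$-model satisfying all declarations in $\Gamma$ satisfies $M:\sigma$. *)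

theory Defs
  imports Main
begin

text \<open>The countable set of term variables is taken to be countably infinite: with too few
  variables the extensionality rule below would lose its force for want of fresh ones.\<close>

type_synonym var = nat

datatype cl =
    Var var
  | S
  | K
  | I
  | App cl cl  (infixl \<open>\<bullet>\<close> 90)

primrec vars :: "cl \<Rightarrow> var set" where
  "vars (Var x) = {x}"
| "vars S = {}"
| "vars K = {}"
| "vars I = {}"
| "vars (M \<bullet> N) = vars M \<union> vars N"

inductive eq_eta :: "cl \<Rightarrow> cl \<Rightarrow> bool"  (infix \<open>=\<^sub>\<eta>\<close> 50) where
  refl: "M =\<^sub>\<eta> M"
| S: "S \<bullet> M \<bullet> N \<bullet> L =\<^sub>\<eta> (M \<bullet> L) \<bullet> (N \<bullet> L)"
| K: "K \<bullet> M \<bullet> N =\<^sub>\<eta> M"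
| I: "I \<bullet> M =\<^sub>\<eta> M"
| sym: "M =\<^sub>\<eta> N \<Longrightarrow> N =\<^sub>\<eta> M"
| trans: "M =\<^sub>\<eta> N \<Longrightarrow> N =\<^sub>\<eta> L \<Longrightarrow> M =\<^sub>\<eta> L"
| appL: "M =\<^sub>\<eta> N \<Longrightarrow> M \<bullet> P =\<^sub>\<eta> N \<bullet> P"
| appR: "M =\<^sub>\<eta> N \<Longrightarrow> P \<bullet> M =\<^sub>\<eta> P \<bullet> N"
| ext: "M \<bullet> Var x =\<^sub>\<eta> N \<bullet> Var x \<Longrightarrow> x \<notin> vars M \<Longrightarrow> x \<notin> vars N \<Longrightarrow> M =\<^sub>\<eta> N"

datatype 'a ty =
    Atom 'a
  | Fun "'a ty" "'a ty"  (infixr \<open>\<rightarrow>\<close> 60)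

text \<open>A set of declarations may be infinite, and may declare every variable.\<close>

definition is_basis :: "(var \<times> 'a ty) set \<Rightarrow> bool" where
  "is_basis \<Gamma> \<longleftrightarrow> (\<forall>x \<sigma> \<tau>. (x, \<sigma>) \<in> \<Gamma> \<longrightarrow> (x, \<tau>) \<in> \<Gamma> \<longrightarrow> \<sigma> = \<tau>)"

inductive has_type :: "(var \<times> 'a ty) set \<Rightarrow> cl \<Rightarrow> 'a ty \<Rightarrow> bool"
    (\<open>(_ \<turnstile> _ : _)\<close> [51, 51, 51] 50) for \<Gamma> where
  Var: "(x, \<sigma>) \<in> \<Gamma> \<Longrightarrow> \<Gamma> \<turnstile> Var x : \<sigma>"
| S: "\<Gamma> \<turnstile> S : (\<sigma> \<rightarrow> (\<rho> \<rightarrow> \<tau>)) \<rightarrow> ((\<sigma> \<rightarrow> \<rho>) \<rightarrow> (\<sigma> \<rightarrow> \<tau>))"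
| K: "\<Gamma> \<turnstile> K : \<sigma> \<rightarrow> (\<tau> \<rightarrow> \<sigma>)"
| I: "\<Gamma> \<turnstile> I : \<sigma> \<rightarrow> \<sigma>"
| App: "\<Gamma> \<turnstile> M : \<sigma> \<rightarrow> \<tau> \<Longrightarrow> \<Gamma> \<turnstile> N : \<sigma> \<Longrightarrow> \<Gamma> \<turnstile> M \<bullet> N : \<tau>"
| eq: "\<Gamma> \<turnstile> M : \<sigma> \<Longrightarrow> M =\<^sub>\<eta> N \<Longrightarrow> \<Gamma> \<turnstile> N : \<sigma>"

locale lcl_structure =
  fixes D :: "'d set"
    and A :: "'a ty \<Rightarrow> 'd set"
    and app :: "'d \<Rightarrow> 'd \<Rightarrow> 'd"  (infixl \<open>\<cdot>\<close> 90)
    and s k i :: 'd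
  assumes D_nonempty: "D \<noteq> {}"
    and A_subset: "A \<sigma> \<subseteq> D"
    and app_closed: "d \<in> D \<Longrightarrow> e \<in> D \<Longrightarrow> d \<cdot> e \<in> D"
    and app_ext: "d\<^sub>1 \<in> D \<Longrightarrow> d\<^sub>2 \<in> D \<Longrightarrow> (\<And>e. e \<in> D \<Longrightarrow> d\<^sub>1 \<cdot> e = d\<^sub>2 \<cdot> e) \<Longrightarrow> d\<^sub>1 = d\<^sub>2"
    and app_type: "d \<in> A (\<sigma> \<rightarrow> \<tau>) \<Longrightarrow> e \<in> A \<sigma> \<Longrightarrow> d \<cdot> e \<in> A \<tau>"
    and s_type: "s \<in> A ((\<sigma> \<rightarrow> (\<tau> \<rightarrow> \<rho>)) \<rightarrow> ((\<sigma> \<rightarrow> \<tau>) \<rightarrow> (\<sigma> \<rightarrow> \<rho>)))"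
    and s_app: "d \<in> D \<Longrightarrow> e \<in> D \<Longrightarrow> f \<in> D \<Longrightarrow> s \<cdot> d \<cdot> e \<cdot> f = (d \<cdot> f) \<cdot> (e \<cdot> f)"
    and k_type: "k \<in> A (\<sigma> \<rightarrow> (\<tau> \<rightarrow> \<sigma>))"
    and k_app: "d \<in> D \<Longrightarrow> e \<in> D \<Longrightarrow> k \<cdot> d \<cdot> e = d"
    and i_type: "i \<in> A (\<sigma> \<rightarrow> \<sigma>)"
    and i_app: "d \<in> D \<Longrightarrow> i \<cdot> d = d"

locale lcl_model = lcl_structure D A app s k i
  for D :: "'d set"
    and A :: "'a ty \<Rightarrow> 'd set"
    and app :: "'d \<Rightarrow> 'd \<Rightarrow> 'd"  (infixl \<open>\<cdot>\<close> 90)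
    and s k i :: 'd +
  fixes env :: "var \<Rightarrow> 'd"
  assumes env_in_D: "env x \<in> D"

primrec interp :: "('d \<Rightarrow> 'd \<Rightarrow> 'd) \<Rightarrow> 'd \<Rightarrow> 'd \<Rightarrow> 'd \<Rightarrow> (var \<Rightarrow> 'd) \<Rightarrow> cl \<Rightarrow> 'd" where
  "interp app s k i env (Var x) = env x"
| "interp app s k i env S = s"
| "interp app s k i env K = k"
| "interp app s k i env I = i"
| "interp app s k i env (M \<bullet> N) = app (interp app s k i env M) (interp app s k i env N)"

definition satisfies ::
    "('a ty \<Rightarrow> 'd set) \<Rightarrow> ('d \<Rightarrow> 'd \<Rightarrow> 'd) \<Rightarrow> 'd \<Rightarrow> 'd \<Rightarrow> 'd \<Rightarrow> (var \<Rightarrow> 'd) \<Rightarrow> cl \<Rightarrow> 'a ty \<Rightarrow> bool" where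
  "satisfies A app s k i env M \<sigma> \<longleftrightarrow> interp app s k i env M \<in> A \<sigma>"

text \<open>HOL cannot quantify over types inside a formula, so semantic consequence is relative to a
  type from which the domains are drawn; a domain is an arbitrary nonempty subset of it.\<close>

definition entails :: "'d itself \<Rightarrow> (var \<times> 'a ty) set \<Rightarrow> cl \<Rightarrow> 'a ty \<Rightarrow> bool" where
  "entails (_ :: 'd itself) \<Gamma> M \<sigma> \<longleftrightarrow>
    (\<forall>(D :: 'd set) A app s k i env.
      lcl_model D A app s k i env \<longrightarrow>
      (\<forall>(x, \<tau>) \<in> \<Gamma>. satisfies A app s k i env (Var x) \<tau>) \<longrightarrow>
      satisfies A app s k i env M \<sigma>)"

end

theory Submission
  imports Defs "HOL-Library.Countable"
begin

text \<open>Take the term model: modulo \<open>=\<^sub>\<eta>\<close>, terms form an extensional applicative structure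
  (extensionality by testing on a fresh variable), and \<open>A \<sigma>\<close> is the set of classes of terms of
  type \<open>\<sigma>\<close> under \<open>\<Gamma>\<close>. With each variable denoting its own class, every term denotes its own
  class, so validity in this one model already yields derivability, the rule (eq) making the
  choice of representative irrelevant. There are only countably many terms, so the classes
  embed into any infinite type.\<close>

instance cl :: countable
  by countable_datatype

lemma finite_vars: "finite (vars M)"
  by (induction M) auto

lemma eq_eta_App: "M =\<^sub>\<eta> M' \<Longrightarrow> N =\<^sub>\<eta> N' \<Longrightarrow> M \<bullet> N =\<^sub>\<eta> M' \<bullet> N'"
  by (rule eq_eta.trans[OF eq_eta.appL eq_eta.appR])

text \<open>Only finitely many variables occur in \<open>M\<close> and \<open>N\<close>, so some
  fresh \<open>Var x\<close> can serve as \<open>P\<close> in the rule \<open>ext\<close>.\<close>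

lemma eq_eta_extensional:
  assumes "\<And>P. M \<bullet> P =\<^sub>\<eta> N \<bullet> P"
  shows "M =\<^sub>\<eta> N"
proof -
  obtain x where "x \<notin> vars M \<union> vars N"
    using ex_new_if_finite[OF infinite_UNIV_nat, of "vars M \<union> vars N"] finite_vars by auto
  then show ?thesis
    using eq_eta.ext[OF assms, of x] by simp
qed

text \<open>Such a \<open>q\<close> serves as a quotient map with values in the given type: choose a
  representative of the class, number it by \<open>to_nat\<close>, and inject the number.\<close>

lemma ex_eq_eta_class_embedding:
  assumes "infinite (UNIV :: 'd set)"
  shows "\<exists>q :: cl \<Rightarrow> 'd. \<forall>M N. q M = q N \<longleftrightarrow> M =\<^sub>\<eta> N"
proof -
  obtain f :: "nat \<Rightarrow> 'd" where f: "inj f"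
    using infinite_countable_subset[OF assms] by blast
  define rep where "rep M = (SOME N. M =\<^sub>\<eta> N)" for M
  have rep: "M =\<^sub>\<eta> rep M" for M
    unfolding rep_def by (rule someI[of _ M]) (rule eq_eta.refl)
  have "rep M = rep N \<longleftrightarrow> M =\<^sub>\<eta> N" for M N
  proof
    assume "rep M = rep N"
    then have "M =\<^sub>\<eta> rep N"
      using rep[of M] by simp
    then show "M =\<^sub>\<eta> N"
      by (rule eq_eta.trans[OF _ eq_eta.sym[OF rep]])
  next
    assume "M =\<^sub>\<eta> N"
    \<comment> \<open>Equivalent terms give \<open>SOME\<close> the same predicate, hence the same
      choice.\<close>
    then have "M =\<^sub>\<eta> L \<longleftrightarrow> N =\<^sub>\<eta> L" for L
      using eq_eta.trans[of M N L] eq_eta.trans[of N M L] eq_eta.sym[of M N] by blast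
    then show "rep M = rep N"
      by (simp add: rep_def)
  qed
  then have "\<forall>M N. f (to_nat (rep M)) = f (to_nat (rep N)) \<longleftrightarrow> M =\<^sub>\<eta> N"
    using f by (simp add: inj_eq)
  then show ?thesis
    by (rule exI[of _ "\<lambda>M. f (to_nat (rep M))"])
qed

locale term_model =
  fixes q :: "cl \<Rightarrow> 'd" and \<Gamma> :: "(var \<times> 'a ty) set"
  assumes q_eq_iff: "q M = q N \<longleftrightarrow> M =\<^sub>\<eta> N"
begin

text \<open>Application of classes through chosen representatives; arguments outside
  \<open>range q\<close> get arbitrary ones, which is harmless since the domain will be
  \<open>range q\<close>.\<close>

definition app :: "'d \<Rightarrow> 'd \<Rightarrow> 'd" where
  "app d e = q (inv q d \<bullet> inv q e)"

definition A :: "'a ty \<Rightarrow> 'd set" where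
  "A \<sigma> = q ` {M. \<Gamma> \<turnstile> M : \<sigma>}"

lemma app_q [simp]: "app (q M) (q N) = q (M \<bullet> N)"
proof -
  \<comment> \<open>\<open>inv q\<close> need not return \<open>L\<close> itself, only a member of
    its class; congruence then suffices.\<close>
  have "inv q (q L) =\<^sub>\<eta> L" for L
    by (simp add: f_inv_into_f flip: q_eq_iff)
  then show ?thesis
    by (simp add: app_def q_eq_iff eq_eta_App)
qed

lemma q_in_A_iff [simp]: "q M \<in> A \<sigma> \<longleftrightarrow> \<Gamma> \<turnstile> M : \<sigma>"
proof
  assume "q M \<in> A \<sigma>"
  then obtain N where "N =\<^sub>\<eta> M" "\<Gamma> \<turnstile> N : \<sigma>"
    unfolding A_def by (auto simp flip: q_eq_iff)
  then show "\<Gamma> \<turnstile> M : \<sigma>"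
    by (rule has_type.eq[rotated])
qed (simp add: A_def)

lemma is_lcl_model: "lcl_model (range q) A app (q S) (q K) (q I) (\<lambda>x. q (Var x))"
proof
  fix d\<^sub>1 d\<^sub>2
  assume "d\<^sub>1 \<in> range q" "d\<^sub>2 \<in> range q" and *: "\<And>e. e \<in> range q \<Longrightarrow> app d\<^sub>1 e = app d\<^sub>2 e"
  then obtain M N where MN: "d\<^sub>1 = q M" "d\<^sub>2 = q N"
    by blast
  have "M \<bullet> P =\<^sub>\<eta> N \<bullet> P" for P
    using *[OF rangeI, of P] MN by (simp add: q_eq_iff)
  then show "d\<^sub>1 = d\<^sub>2"
    using MN eq_eta_extensional by (simp add: q_eq_iff)
next
  fix d e \<sigma> \<tau>
  assume "d \<in> A (\<sigma> \<rightarrow> \<tau>)" "e \<in> A \<sigma>"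
  then show "app d e \<in> A \<tau>"
    \<comment> \<open>\<open>A \<tau>\<close> stays folded so that \<open>q_in_A_iff\<close> can
      reduce the goal to a typing.\<close>
    unfolding A_def[of "\<sigma> \<rightarrow> \<tau>"] A_def[of \<sigma>] by (auto intro: has_type.App)
next
  show "A \<sigma> \<subseteq> range q" for \<sigma>
    by (auto simp: A_def)
next
  fix d e f
  assume "d \<in> range q" "e \<in> range q" "f \<in> range q"
  then show "app (app (app (q S) d) e) f = app (app d f) (app e f)"
    \<comment> \<open>Read backwards, \<open>q_eq_iff\<close> turns the axiom into an equation in
      the domain.\<close>
    using eq_eta.S by (auto simp flip: q_eq_iff)
next
  fix d e
  assume "d \<in> range q" "e \<in> range q"
  then show "app (app (q K) d) e = d"
    using eq_eta.K by (auto simp flip: q_eq_iff)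
next
  fix d
  assume "d \<in> range q"
  then show "app (q I) d = d"
    using eq_eta.I by (auto simp flip: q_eq_iff)
next
  fix d e
  assume "d \<in> range q" "e \<in> range q"
  then show "app d e \<in> range q"
    by (simp add: app_def)
qed (simp_all add: has_type.S has_type.K has_type.I)

text \<open>By \<open>app_q\<close>, \<open>q\<close> is a homomorphism from terms to the
  model.\<close>

lemma interp_eq_q: "interp app (q S) (q K) (q I) (\<lambda>x. q (Var x)) M = q M"
  by (induction M) simp_all

end

theorem mainTheorem18:
  fixes \<Gamma> :: "(var \<times> 'a ty) set" and M :: cl and \<sigma> :: "'a ty"
  assumes "infinite (UNIV :: 'd set)"
    and "is_basis \<Gamma>"
    and "entails TYPE('d) \<Gamma> M \<sigma>"
  shows "\<Gamma> \<turnstile> M : \<sigma>"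
proof -
  obtain q :: "cl \<Rightarrow> 'd" where "\<forall>M N. q M = q N \<longleftrightarrow> M =\<^sub>\<eta> N"
    using ex_eq_eta_class_embedding[OF assms(1)] by blast
  then interpret term_model q \<Gamma>
    by unfold_locales blast
  have "\<forall>(x, \<tau>) \<in> \<Gamma>. satisfies A app (q S) (q K) (q I) (\<lambda>x. q (Var x)) (Var x) \<tau>"
    by (auto simp: satisfies_def intro: has_type.Var)
  then have "satisfies A app (q S) (q K) (q I) (\<lambda>x. q (Var x)) M \<sigma>"
    using assms(3) is_lcl_model unfolding entails_def by blast
  then show ?thesis
    by (simp add: satisfies_def interp_eq_q)
qed

end
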